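(* Let $1<q<p$, let $(X,\mu)$ be a non-atomic probability space, let $\mathcal{T}$ be a tree on $X$, and let $\phi\ge 0$ be a measurable function on $X$ with $\int_X\phi\,d\mu=f$ and $\int_X\phi^q\,d\mu=A$, where $f,A$ are finite. If $I=\int_X(\mathcal{M}_{\mathcal{T}}\phi)^p\,d\mu$, then $$I\le f^p-\frac{p}{p-q}f^{p-q}A+\frac{p}{p-q}\int_X(\mathcal{M}_{\mathcal{T}}\phi)^{p-q}\phi^q\,d\mu.$$
   Context: Let $(X,\mu)$ be a non-atomic probability space. Two measurable sets $A,B\subseteq X$ are almost disjoint if $\mu(A\cap B)=0$. A set $\mathcal{T}$ of measurable subsets of $X$ is called a tree if: (i) $X\in\mathcal{T}$ and $\mu(I)>0$ for every $I\in\mathcal{T}$; (ii) to every $I\in\mathcal{T}$ there corresponds a finite or countable subset $\mathcal{C}(I)\subseteq\mathcal{T}$ containing at least two elements such that (a) the elements of $\mathcal{C}(I)$ are pairwise almost disjoint subsets of $I$, and (b) $I=\bigcup\mathcal{C}(I)$; (iii) $\mathcal{T}=\bigcup_{m\ge 0}\mathcal{T}_{(m)}$, where $\mathcal{T}_{(0)}=\{X\}$ and $\mathcal{T}_{(m+1)}=\bigcup_{I\in\mathcal{T}_{(m)}}\mathcal{C}(I)$; (iv) $\lim_{m\to\infty}\sup_{I\in\mathcal{T}_{(m)}}\mu(I)=0$. For $\phi\in L^1(X,\mu)$ the associated maximal operator is $$\mathcal{M}_{\mathcal{T}}\phi(x)=\sup\Big\{\frac{1}{\mu(I)}\int_I|\phi|\,d\mu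 : x\in I\in\mathcal{T}\Big\}.$$ Integrals of non-negative functions are understood as elements of $[0,\infty]$. *)

theory Defs
  imports "HOL-Probability.Probability"
begin

definition nonatomic :: "'a measure \<Rightarrow> bool" where
  "nonatomic M \<longleftrightarrow>
     (\<forall>E\<in>sets M. 0 < emeasure M E \<longrightarrow>
        (\<exists>F\<in>sets M. F \<subseteq> E \<and> 0 < emeasure M F \<and> emeasure M F < emeasure M E))"

definition almost_disjoint :: "'a measure \<Rightarrow> 'a set \<Rightarrow> 'a set \<Rightarrow> bool" where
  "almost_disjoint M E F \<longleftrightarrow> emeasure M (E \<inter> F) = 0"

primrec tree_level :: "'a set \<Rightarrow> ('a set \<Rightarrow> 'a set set) \<Rightarrow> nat \<Rightarrow> 'a set set" where
  "tree_level X C 0 = {X}"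
| "tree_level X C (Suc m) = (\<Union>I\<in>tree_level X C m. C I)"

definition is_tree :: "'a measure \<Rightarrow> 'a set set \<Rightarrow> bool" where
  "is_tree M T \<longleftrightarrow>
     T \<subseteq> sets M \<and>
     space M \<in> T \<and> (\<forall>I\<in>T. 0 < emeasure M I) \<and>
     (\<exists>C. (\<forall>I\<in>T. C I \<subseteq> T \<and> countable (C I) \<and> (\<exists>J\<in>C I. \<exists>K\<in>C I. J \<noteq> K) \<and>
                 (\<forall>J\<in>C I. J \<subseteq> I) \<and> pairwise (almost_disjoint M) (C I) \<and> I = \<Union>(C I)) \<and>
          T = (\<Union>m. tree_level (space M) C m) \<and>
          (\<lambda>m. SUP I\<in>tree_level (space M) C m. emeasure M I) \<longlonglongrightarrow> 0)"

definition maximal_op :: "'a measure \<Rightarrow> 'a set set \<Rightarrow> ('a \<Rightarrow> real) \<Rightarrow> 'a \<Rightarrow> ennreal" where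
  "maximal_op M T \<phi> x =
     (SUP I\<in>{I\<in>T. x \<in> I}. (\<integral>\<^sup>+y\<in>I. ennreal \<bar>\<phi> y\<bar> \<partial>M) / emeasure M I)"

(* Powers of [0, \<infinity>]-valued functions; meant for exponents a > 0 only, where
   0 to the a is 0 and \<infinity> to the a is \<infinity>. *)
definition ennreal_powr :: "ennreal \<Rightarrow> real \<Rightarrow> ennreal" where
  "ennreal_powr x a = (if x = \<infinity> then \<infinity> else ennreal (enn2real x powr a))"

end

(* Write m for the maximal function and d\<nu> = \<phi>^q d\<mu>.  The tangent line inequality for t \<mapsto> t^q at
   l gives l^q \<mu>(I) \<le> \<nu>(I) for every I in the tree on which \<phi> has average at least l.  Summing
   over the maximal such I yields the weak type bound l^q \<mu>{m > l} \<le> \<nu>{m > l}.  Since m \<ge> f, the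
   layer cake formula gives
     \<integral> m^p d\<mu> = f^p + \<integral>_{l \<ge> f} p l^(p-1) \<mu>{m > l} dl
             \<le> f^p + p/(p-q) \<integral>_{l \<ge> f} (p-q) l^(p-q-1) \<nu>{m > l} dl
             = f^p + p/(p-q) (\<integral> m^(p-q) d\<nu> - f^(p-q) A).
   This needs f > 0; for f = 0 everything vanishes. *)

theory Submission
  imports Defs
begin

section \<open>Tangent line inequality and additivity over almost disjoint families\<close>

text \<open>Young's inequality for x and l^(q-1) with the conjugate exponents q and q/(q-1). Both
  sides carry only nonnegative terms, so that the inequality can be integrated in
  \<open>ennreal\<close> without subtraction.\<close>

lemma powr_ge_tangent:
  fixes l x q :: real
  assumes "1 < q" "0 < l" "0 \<le> x"
  shows "l powr q + q * l powr (q - 1) * x \<le> x powr q + q * l powr q"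
proof -
  define r where "r = q / (q - 1)"
  have "x * l powr (q - 1) \<le> x powr q / q + (l powr (q - 1)) powr r / r"
    by (rule Youngs_inequality) (use assms in \<open>auto simp: r_def field_simps\<close>)
  moreover have "(l powr (q - 1)) powr r = l powr q"
    using assms by (simp add: powr_powr r_def)
  ultimately have "x * l powr (q - 1) \<le> x powr q / q + l powr q / r"
    by simp
  then have "q * (x * l powr (q - 1)) \<le> q * (x powr q / q + l powr q / r)"
    using assms by (intro mult_left_mono) auto
  also have "\<dots> = x powr q + (q - 1) * l powr q"
    using assms by (simp add: r_def field_simps)
  finally show ?thesis
    by (simp add: algebra_simps)
qed

text \<open>Removing the set \<open>Z\<close> of all pairwise overlaps, null because the family is
  countable, makes the family disjoint and changes no measure.\<close>

lemma emeasure_UN_almost_disjoint: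
  assumes sets: "\<And>i. i \<in> I \<Longrightarrow> X i \<in> sets M" and I: "countable I"
    and null: "\<And>i j. i \<in> I \<Longrightarrow> j \<in> I \<Longrightarrow> i \<noteq> j \<Longrightarrow> X i \<inter> X j \<in> null_sets M"
  shows "emeasure M (\<Union>i\<in>I. X i) = (\<integral>\<^sup>+i. emeasure M (X i) \<partial>count_space I)"
proof -
  define Z where "Z = (\<Union>i\<in>I. \<Union>j\<in>I - {i}. X i \<inter> X j)"
  have Z: "Z \<in> null_sets M"
    unfolding Z_def by (intro null_sets_UN' I countable_Diff null) auto
  have "emeasure M (\<Union>i\<in>I. X i) = emeasure M ((\<Union>i\<in>I. X i) - Z)"
    using Z I sets by (intro emeasure_Diff_null_set[symmetric]) auto
  also have "(\<Union>i\<in>I. X i) - Z = (\<Union>i\<in>I. X i - Z)"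
    by auto
  also have "emeasure M \<dots> = (\<integral>\<^sup>+i. emeasure M (X i - Z) \<partial>count_space I)"
    using I sets Z
    by (intro emeasure_UN_countable) (auto simp: disjoint_family_on_def Z_def)
  also have "\<dots> = (\<integral>\<^sup>+i. emeasure M (X i) \<partial>count_space I)"
    using Z sets by (intro nn_integral_cong emeasure_Diff_null_set) auto
  finally show ?thesis .
qed

section \<open>Layer cake formula above a positive level\<close>

text \<open>The fundamental theorem of calculus for l^r on the interval from f to m. Starting at f >
  0 avoids the singularity of l^(r-1) at 0 when r < 1, and accounts for the term f^r.\<close>

lemma nn_integral_powr_layer:
  fixes f r :: real and m :: ennreal
  assumes "0 < f" "0 < r" "ennreal f \<le> m"
  shows "ennreal_powr m r = ennreal (f powr r) +
    (\<integral>\<^sup>+l. ennreal (r * l powr (r - 1)) * indicator {l. f \<le> l \<and> ennreal l < m} l \<partial>lborel)"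
    (is "_ = _ + ?K m")
proof -
  have FTC: "(\<integral>\<^sup>+l. ennreal (r * l powr (r - 1)) * indicator {f..b} l \<partial>lborel)
      = ennreal (b powr r - f powr r)" if "f \<le> b" for b
    using that assms by (intro nn_integral_FTC_Icc) (auto intro!: derivative_eq_intros)
  have fin: "?K (ennreal b) = ennreal (b powr r - f powr r)" if "f \<le> b" for b
  proof -
    have "?K (ennreal b) = (\<integral>\<^sup>+l. ennreal (r * l powr (r - 1)) * indicator {f..b} l \<partial>lborel)"
      \<comment> \<open>The strict condition l < b and the closed interval differ only at the null
        point b.\<close>
      using AE_lborel_singleton[of b] assms
      by (intro nn_integral_cong_AE) (auto simp: indicator_def ennreal_less_iff)
    then show ?thesis using FTC[OF that] by simp
  qed
  show ?thesis
  proof (cases m)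
    case (real b)
    then have "f \<le> b" using assms by simp
    moreover have "f powr r \<le> b powr r"
      using \<open>f \<le> b\<close> assms by (intro powr_mono2) auto
    ultimately show ?thesis
      using real fin by (simp add: ennreal_powr_def flip: ennreal_plus)
  next
    case top
    have "?K top = top"
    proof (rule ccontr)
      assume "?K top \<noteq> top"
      then obtain n where n: "?K top < of_nat n"
        using ennreal_Ex_less_of_nat by (auto simp: less_top)
      \<comment> \<open>Chosen so that b^r - f^r = n: the integral up to b is already n, which
        contradicts the bound below n.\<close>
      define b where "b = (f powr r + real n) powr (1 / r)"
      have "f = (f powr r) powr (1 / r)"
        using assms by (simp add: powr_powr)
      also have "\<dots> \<le> b"
        unfolding b_def using assms by (intro powr_mono2) auto
      finally have "f \<le> b" .
      have "b powr r = f powr r + real n"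
        using assms by (simp add: b_def powr_powr)
      then have "of_nat n = ?K (ennreal b)"
        using fin[OF \<open>f \<le> b\<close>] by (simp add: ennreal_of_nat_eq_real_of_nat)
      also have "\<dots> \<le> ?K top"
        by (intro nn_integral_mono) (auto simp: indicator_def)
      finally show False
        using n by simp
    qed
    then show ?thesis
      using top by (simp add: ennreal_powr_def)
  qed
qed

text \<open>Integrates the pointwise formula over \<open>N\<close> and exchanges the integrals. The
  measure is a parameter because the formula serves both \<mu> with exponent p and \<phi>^q d\<mu>
  with exponent p - q.\<close>

lemma nn_integral_powr_layer_cake:
  fixes f r :: real and m :: "'a \<Rightarrow> ennreal"
  assumes "0 < f" "0 < r" and N: "finite_measure N" and m[measurable]: "m \<in> borel_measurable N"
    and le: "\<And>x. x \<in> space N \<Longrightarrow> ennreal f \<le> m x"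
  shows "(\<integral>\<^sup>+x. ennreal_powr (m x) r \<partial>N) = ennreal (f powr r) * emeasure N (space N) +
    (\<integral>\<^sup>+l\<in>{f..}. ennreal (r * l powr (r - 1)) * emeasure N {x\<in>space N. ennreal l < m x} \<partial>lborel)"
proof -
  interpret finite_measure N by fact
  interpret pair_sigma_finite N lborel
    by unfold_locales
  let ?k = "\<lambda>x l. ennreal (r * l powr (r - 1)) * indicator {l. f \<le> l \<and> ennreal l < m x} l"
  have k[measurable]: "(\<lambda>(x, l). ?k x l) \<in> borel_measurable (N \<Otimes>\<^sub>M lborel)"
    by (simp add: indicator_def case_prod_beta) measurable
  have "(\<integral>\<^sup>+x. ennreal_powr (m x) r \<partial>N)
      = (\<integral>\<^sup>+x. ennreal (f powr r) + (\<integral>\<^sup>+l. ?k x l \<partial>lborel) \<partial>N)"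
    using assms by (intro nn_integral_cong nn_integral_powr_layer) auto
  also have "\<dots> = ennreal (f powr r) * emeasure N (space N) + (\<integral>\<^sup>+x. (\<integral>\<^sup>+l. ?k x l \<partial>lborel) \<partial>N)"
    by (subst nn_integral_add) (auto intro!: borel_measurable_nn_integral k)
  also have "(\<integral>\<^sup>+x. (\<integral>\<^sup>+l. ?k x l \<partial>lborel) \<partial>N) = (\<integral>\<^sup>+l. (\<integral>\<^sup>+x. ?k x l \<partial>N) \<partial>lborel)"
    by (rule Fubini'[symmetric]) (rule k)
  also have "(\<lambda>l. \<integral>\<^sup>+x. ?k x l \<partial>N) = (\<lambda>l. ennreal (r * l powr (r - 1)) *
      emeasure N {x\<in>space N. ennreal l < m x} * indicator {f..} l)"
  proof
    fix l
    have "(\<integral>\<^sup>+x. ?k x l \<partial>N) = (\<integral>\<^sup>+x. (ennreal (r * l powr (r - 1)) * indicator {f..} l) *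
        indicator {x\<in>space N. ennreal l < m x} x \<partial>N)"
      by (intro nn_integral_cong) (auto simp: indicator_def)
    then show "(\<integral>\<^sup>+x. ?k x l \<partial>N) = ennreal (r * l powr (r - 1)) *
        emeasure N {x\<in>space N. ennreal l < m x} * indicator {f..} l"
      by (simp add: nn_integral_cmult mult_ac)
  qed
  finally show ?thesis .
qed

section \<open>Comparison of two measures on unions of tree members\<close>

text \<open>Union of the members of \<open>G\<close> reached first when descending at most \<open>n\<close> generations below \<open>I\<close>.
  Stopping at members of \<open>G\<close> makes the pieces almost disjoint, and the recursion replaces the
  choice of maximal members of \<open>G\<close> by an induction on \<open>n\<close>.\<close>

primrec stopped_union :: "('a set \<Rightarrow> 'a set set) \<Rightarrow> 'a set set \<Rightarrow> nat \<Rightarrow> 'a set \<Rightarrow> 'a set" where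
  "stopped_union C G 0 I = (if I \<in> G then I else {})"
| "stopped_union C G (Suc n) I = (if I \<in> G then I else (\<Union>J\<in>C I. stopped_union C G n J))"

text \<open>\<open>tree_level\<close> adds generations at the bottom, whereas
  \<open>stopped_union\<close> recurses from the top. Peeling off the first generation reconciles
  the two.\<close>

lemma tree_level_Suc_root: "tree_level X C (Suc m) = (\<Union>I\<in>C X. tree_level I C m)"
  by (induction m) auto

text \<open>A fixed child map without a distinguished root, so that inductions can descend from any
  member of \<open>T\<close>.\<close>

locale branching =
  fixes M :: "'a measure" and T :: "'a set set" and C :: "'a set \<Rightarrow> 'a set set"
  assumes sets_T: "T \<subseteq> sets M"
    and children: "\<And>I. I \<in> T \<Longrightarrow> C I \<subseteq> T"
    and countable_children: "\<And>I. I \<in> T \<Longrightarrow> countable (C I)"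
    and children_subset: "\<And>I J. I \<in> T \<Longrightarrow> J \<in> C I \<Longrightarrow> J \<subseteq> I"
    and children_disjoint: "\<And>I. I \<in> T \<Longrightarrow> pairwise (almost_disjoint M) (C I)"
begin

lemma child_in: "I \<in> T \<Longrightarrow> J \<in> C I \<Longrightarrow> J \<in> T"
  using children by blast

lemma tree_level_in: "I \<in> T \<Longrightarrow> J \<in> tree_level I C m \<Longrightarrow> J \<in> T"
  by (induction m arbitrary: J) (auto intro: child_in)

lemma countable_tree_level: "I \<in> T \<Longrightarrow> countable (tree_level I C m)"
  by (induction m) (auto intro!: countable_children intro: tree_level_in)

lemma tree_level_le_root: "I \<in> T \<Longrightarrow> J \<in> tree_level I C m \<Longrightarrow> J \<subseteq> I"
proof (induction m arbitrary: J)
  case (Suc m)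
  then obtain K where "K \<in> tree_level I C m" "J \<in> C K"
    by auto
  then show ?case
    using Suc children_subset[of K J] tree_level_in[of I K m] by (meson order_trans)
qed simp

lemma stopped_union_subset: "I \<in> T \<Longrightarrow> stopped_union C G n I \<subseteq> I"
proof (induction n arbitrary: I)
  case (Suc n)
  have "stopped_union C G n J \<subseteq> I" if "J \<in> C I" for J
    using Suc.IH[of J] child_in[OF Suc.prems that] children_subset[OF Suc.prems that] by blast
  then show ?case
    by (simp add: UN_least)
qed simp

lemma stopped_union_sets: "I \<in> T \<Longrightarrow> stopped_union C G n I \<in> sets M"
proof (induction n arbitrary: I)
  case (Suc n)
  have "(\<Union>J\<in>C I. stopped_union C G n J) \<in> sets M"
    using Suc child_in[OF Suc.prems] countable_children[OF Suc.prems]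
    by (intro sets.countable_UN') auto
  then show ?case
    using Suc.prems sets_T by auto
qed (use sets_T in auto)

lemma stopped_union_le_Union: "I \<in> T \<Longrightarrow> stopped_union C G n I \<subseteq> \<Union>(G \<inter> T)"
proof (induction n arbitrary: I)
  case (Suc n)
  have "stopped_union C G n J \<subseteq> \<Union>(G \<inter> T)" if "J \<in> C I" for J
    using Suc.IH child_in[OF Suc.prems that] .
  then have "(\<Union>J\<in>C I. stopped_union C G n J) \<subseteq> \<Union>(G \<inter> T)"
    by (rule UN_least)
  then show ?case
    using Suc.prems by (simp add: Sup_upper)
qed auto

text \<open>The descent from \<open>I\<close> towards \<open>J\<close> stops at \<open>J\<close> or
  earlier, at a member of \<open>G\<close> that contains \<open>J\<close>.\<close>

lemma tree_level_le_stopped_union: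
  "I \<in> T \<Longrightarrow> J \<in> tree_level I C m \<Longrightarrow> J \<in> G \<Longrightarrow> J \<subseteq> stopped_union C G m I"
proof (induction m arbitrary: I)
  case (Suc m)
  obtain K where K: "K \<in> C I" "J \<in> tree_level K C m"
    using Suc.prems(2) unfolding tree_level_Suc_root by auto
  have "J \<subseteq> stopped_union C G m K"
    using Suc.IH[OF child_in[OF Suc.prems(1) K(1)] K(2) Suc.prems(3)] .
  then have "J \<subseteq> (\<Union>J\<in>C I. stopped_union C G m J)"
    using K(1) by blast
  then show ?case
    using tree_level_le_root[OF Suc.prems(1,2)] by simp
qed simp

lemma stopped_union_Suc: "I \<in> T \<Longrightarrow> stopped_union C G n I \<subseteq> stopped_union C G (Suc n) I"
proof (induction n arbitrary: I)
  case (Suc n)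
  have "stopped_union C G n J \<subseteq> stopped_union C G (Suc n) J" if "J \<in> C I" for J
    using Suc.IH child_in[OF Suc.prems that] .
  then have "(\<Union>J\<in>C I. stopped_union C G n J) \<subseteq> (\<Union>J\<in>C I. stopped_union C G (Suc n) J)"
    by (rule UN_mono[OF order_refl])
  then show ?case
    by (simp only: stopped_union.simps(2)[of C G n I] stopped_union.simps(2)[of C G "Suc n" I]) simp
qed simp

text \<open>Overlaps of the \<open>X J\<close> lie in overlaps of children, which are null for
  \<open>M\<close> and, by absolute continuity, for \<open>N\<close>. Additivity thus holds for both
  measures.\<close>

lemma emeasure_children_family:
  assumes "sets N = sets M" "absolutely_continuous M N" "I \<in> T"
    and X: "\<And>J. J \<in> C I \<Longrightarrow> X J \<subseteq> J" "\<And>J. J \<in> C I \<Longrightarrow> X J \<in> sets M"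
  shows "emeasure N (\<Union>J\<in>C I. X J) = (\<integral>\<^sup>+J. emeasure N (X J) \<partial>count_space (C I))"
proof (rule emeasure_UN_almost_disjoint)
  fix J K assume JK: "J \<in> C I" "K \<in> C I" "J \<noteq> K"
  then have "J \<inter> K \<in> null_sets M"
    using children_disjoint[OF \<open>I \<in> T\<close>] child_in[OF \<open>I \<in> T\<close>] sets_T
    by (auto simp: pairwise_def almost_disjoint_def null_sets_def intro!: sets.Int)
  moreover have "X J \<inter> X K \<subseteq> J \<inter> K"
    using X JK by blast
  ultimately have "X J \<inter> X K \<in> null_sets M"
    using X(2)[OF JK(1)] X(2)[OF JK(2)] by (metis null_sets_subset sets.Int)
  then show "X J \<inter> X K \<in> null_sets N"
    using assms(2) by (auto simp: absolutely_continuous_def)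
qed (use assms countable_children in auto)

text \<open>At a member of \<open>G\<close> the inequality is assumed; elsewhere it is summed over
  the almost disjoint pieces inside the children.\<close>

lemma stopped_union_emeasure_le:
  assumes N: "sets N = sets M" "absolutely_continuous M N"
    and G: "\<And>I. I \<in> G \<Longrightarrow> I \<in> T \<Longrightarrow> c * emeasure M I \<le> emeasure N I"
  shows "I \<in> T \<Longrightarrow> c * emeasure M (stopped_union C G n I) \<le> emeasure N (stopped_union C G n I)"
proof (induction n arbitrary: I)
  case (Suc n)
  have J: "J \<in> T" if "J \<in> C I" for J
    using that children[OF Suc.prems] by auto
  show ?case
  proof (cases "I \<in> G")
    case False
    have "c * emeasure M (\<Union>J\<in>C I. stopped_union C G n J)
        = (\<integral>\<^sup>+J. c * emeasure M (stopped_union C G n J) \<partial>count_space (C I))"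
      using J stopped_union_sets stopped_union_subset Suc.prems
      by (subst emeasure_children_family)
        (auto simp: nn_integral_cmult absolutely_continuous_def)
    also have "\<dots> \<le> (\<integral>\<^sup>+J. emeasure N (stopped_union C G n J) \<partial>count_space (C I))"
      using Suc.IH J by (intro nn_integral_mono) auto
    also have "\<dots> = emeasure N (\<Union>J\<in>C I. stopped_union C G n J)"
      using J stopped_union_sets stopped_union_subset Suc.prems N
      by (subst emeasure_children_family) auto
    finally show ?thesis using False by simp
  qed (use G Suc.prems in auto)
qed (use G in auto)

text \<open>Every member of \<open>G\<close> lies in some generation, so the stopped unions increase
  to the union of \<open>G\<close>, and continuity from below carries the inequality to the
  limit.\<close>

lemma Union_emeasure_le:
  assumes N: "sets N = sets M" "absolutely_continuous M N"
    and T: "I \<in> T" "T = (\<Union>m. tree_level I C m)" and "G \<subseteq> T"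
    and G: "\<And>I. I \<in> G \<Longrightarrow> c * emeasure M I \<le> emeasure N I"
  shows "c * emeasure M (\<Union>G) \<le> emeasure N (\<Union>G)"
proof -
  have eq: "\<Union>G = (\<Union>n. stopped_union C G n I)"
  proof (intro subset_antisym UN_least Union_least)
    fix n show "stopped_union C G n I \<subseteq> \<Union>G"
      using stopped_union_le_Union[OF T(1), of G n] by auto
  next
    fix J assume "J \<in> G"
    then obtain m where "J \<in> tree_level I C m"
      using T \<open>G \<subseteq> T\<close> by auto
    then show "J \<subseteq> (\<Union>n. stopped_union C G n I)"
      using tree_level_le_stopped_union[OF T(1) _ \<open>J \<in> G\<close>] by blast
  qed
  have inc: "incseq (\<lambda>n. stopped_union C G n I)"
    using stopped_union_Suc[OF T(1)] by (intro incseq_SucI) auto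
  have "c * emeasure M (\<Union>G) = (SUP n. c * emeasure M (stopped_union C G n I))"
    unfolding eq using inc stopped_union_sets[OF T(1)]
    by (subst SUP_emeasure_incseq[symmetric]) (auto simp: SUP_mult_left_ennreal)
  also have "\<dots> \<le> (SUP n. emeasure N (stopped_union C G n I))"
    using stopped_union_emeasure_le[OF N G T(1)] by (intro SUP_mono) auto
  also have "\<dots> = emeasure N (\<Union>G)"
    unfolding eq using inc stopped_union_sets[OF T(1)] N
    by (subst SUP_emeasure_incseq[symmetric]) auto
  finally show ?thesis .
qed

end

section \<open>Weak type bound for the maximal function\<close>

lemma density_powr_ge_of_average_ge:
  fixes \<phi> :: "'a \<Rightarrow> real"
  assumes "finite_measure M" and [measurable]: "\<phi> \<in> borel_measurable M" "I \<in> sets M"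
    and nonneg: "\<And>x. x \<in> space M \<Longrightarrow> 0 \<le> \<phi> x" and "1 < q" "0 < l"
    and ge: "ennreal l * emeasure M I \<le> (\<integral>\<^sup>+x\<in>I. ennreal (\<phi> x) \<partial>M)"
  shows "ennreal (l powr q) * emeasure M I \<le> emeasure (density M (\<lambda>x. ennreal (\<phi> x powr q))) I"
proof -
  interpret finite_measure M by fact
  have l: "l powr q = l powr (q - 1) * l"
    using \<open>0 < l\<close> by (simp add: powr_diff)
  \<comment> \<open>The term q l^q \<mu>(I) is added to both sides to match the tangent inequality
    integrated over \<open>I\<close>. It is finite, so it can be cancelled at the end.\<close>
  have "ennreal (l powr q) * emeasure M I + ennreal (q * l powr q) * emeasure M I
      = ennreal (l powr q) * emeasure M I + ennreal (q * l powr (q - 1)) * (ennreal l * emeasure M I)"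
    using assms by (simp add: l ennreal_mult' mult_ac)
  also have "\<dots> \<le> ennreal (l powr q) * emeasure M I +
      ennreal (q * l powr (q - 1)) * (\<integral>\<^sup>+x\<in>I. ennreal (\<phi> x) \<partial>M)"
    by (intro add_left_mono mult_left_mono ge) auto
  also have "\<dots> = (\<integral>\<^sup>+x. ennreal (l powr q) * indicator I x +
      ennreal (q * l powr (q - 1)) * (ennreal (\<phi> x) * indicator I x) \<partial>M)"
    by (simp add: nn_integral_add nn_integral_cmult)
  also have "\<dots> \<le> (\<integral>\<^sup>+x. ennreal (\<phi> x powr q) * indicator I x + ennreal (q * l powr q) * indicator I x \<partial>M)"
    using powr_ge_tangent[of q l] assms
    by (intro nn_integral_mono) (auto simp: indicator_def simp flip: ennreal_mult ennreal_plus intro!: ennreal_leI)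
  also have "\<dots> = emeasure (density M (\<lambda>x. ennreal (\<phi> x powr q))) I + ennreal (q * l powr q) * emeasure M I"
    by (simp add: nn_integral_add nn_integral_cmult emeasure_density)
  finally show ?thesis
    by (simp add: ennreal_mult_eq_top_iff)
qed

text \<open>A supremum exceeds c exactly when one of its terms does. The resulting union of tree
  members yields measurability for countable \<open>T\<close> and is the form to which
  \<open>Union_emeasure_le\<close> applies.\<close>

lemma superlevel_maximal_op:
  assumes "T \<subseteq> sets M"
  shows "{x\<in>space M. c < maximal_op M T \<phi> x} =
    \<Union>{I\<in>T. c < (\<integral>\<^sup>+y\<in>I. ennreal \<bar>\<phi> y\<bar> \<partial>M) / emeasure M I}"
  using assms by (auto simp: maximal_op_def less_SUP_iff dest: sets.sets_into_space)

lemma borel_measurable_maximal_op: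
  assumes "T \<subseteq> sets M" "countable T"
  shows "maximal_op M T \<phi> \<in> borel_measurable M"
proof (rule borel_measurableI_greater)
  fix c
  have "\<Union>{I\<in>T. c < (\<integral>\<^sup>+y\<in>I. ennreal \<bar>\<phi> y\<bar> \<partial>M) / emeasure M I} \<in> sets M"
    using assms by (intro sets.countable_Union countable_Collect) auto
  then show "{x\<in>space M. c < maximal_op M T \<phi> x} \<in> sets M"
    using superlevel_maximal_op[OF assms(1)] by simp
qed

lemma is_tree_sets: "is_tree M T \<Longrightarrow> T \<subseteq> sets M"
  by (simp add: is_tree_def)

lemma is_treeE:
  assumes "is_tree M T"
  obtains C where "branching M T C" "T = (\<Union>m. tree_level (space M) C m)"
proof -
  from assms obtain C where
    C: "\<forall>I\<in>T. C I \<subseteq> T \<and> countable (C I) \<and> (\<exists>J\<in>C I. \<exists>K\<in>C I. J \<noteq> K) \<and>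
          (\<forall>J\<in>C I. J \<subseteq> I) \<and> pairwise (almost_disjoint M) (C I) \<and> I = \<Union>(C I)"
    and T: "T = (\<Union>m. tree_level (space M) C m)"
    unfolding is_tree_def by (elim conjE exE) (rule that)
  have "branching M T C"
  proof
    show "T \<subseteq> sets M"
      by (rule is_tree_sets[OF assms])
  qed (use bspec[OF C] in simp_all)
  then show thesis
    using T by (rule that)
qed

lemma is_tree_countable:
  assumes "is_tree M T"
  shows "countable T"
proof -
  obtain C where C: "branching M T C" "T = (\<Union>m. tree_level (space M) C m)"
    using is_treeE[OF assms] .
  have "space M \<in> T"
    using assms by (simp add: is_tree_def)
  have "countable (\<Union>m. tree_level (space M) C m)"
    by (intro countable_UN countableI_type branching.countable_tree_level[OF C(1) \<open>space M \<in> T\<close>])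
  then show ?thesis
    by (rule ssubst[OF C(2)])
qed

lemma maximal_op_weak_type:
  fixes \<phi> :: "'a \<Rightarrow> real" and l q :: real
  assumes "finite_measure M" "is_tree M T" and [measurable]: "\<phi> \<in> borel_measurable M"
    and nonneg: "\<And>x. x \<in> space M \<Longrightarrow> 0 \<le> \<phi> x" and "1 < q" "0 < l"
  defines "E \<equiv> {x\<in>space M. ennreal l < maximal_op M T \<phi> x}"
  shows "ennreal (l powr q) * emeasure M E \<le> emeasure (density M (\<lambda>x. ennreal (\<phi> x powr q))) E"
proof -
  interpret finite_measure M by fact
  obtain C where C: "branching M T C" "T = (\<Union>m. tree_level (space M) C m)"
    using is_treeE[OF assms(2)] .
  note sets_T = is_tree_sets[OF assms(2)]
  have root: "space M \<in> T" and pos: "\<And>I. I \<in> T \<Longrightarrow> 0 < emeasure M I"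
    using assms(2) by (simp_all add: is_tree_def)
  show ?thesis
    unfolding E_def superlevel_maximal_op[OF sets_T]
  proof (rule branching.Union_emeasure_le[OF C(1) _ _ root C(2)])
    fix I assume "I \<in> {I \<in> T. ennreal l < (\<integral>\<^sup>+y\<in>I. ennreal \<bar>\<phi> y\<bar> \<partial>M) / emeasure M I}"
    then have I: "I \<in> T" "ennreal l < (\<integral>\<^sup>+y\<in>I. ennreal \<bar>\<phi> y\<bar> \<partial>M) / emeasure M I"
      by auto
    have abs: "(\<integral>\<^sup>+y\<in>I. ennreal \<bar>\<phi> y\<bar> \<partial>M) = (\<integral>\<^sup>+y\<in>I. ennreal (\<phi> y) \<partial>M)"
      using nonneg by (intro nn_integral_cong) simp
    have "ennreal l * emeasure M I
        \<le> (\<integral>\<^sup>+y\<in>I. ennreal \<bar>\<phi> y\<bar> \<partial>M) / emeasure M I * emeasure M I"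
      using I(2) by (intro mult_right_mono) auto
    \<comment> \<open>Undoing the division requires \<mu>(I) to be positive and finite.\<close>
    also have "\<dots> = (\<integral>\<^sup>+y\<in>I. ennreal (\<phi> y) \<partial>M)"
      using ennreal_divide_self[of "emeasure M I"] pos[OF I(1)] emeasure_finite[of I]
      by (simp add: ennreal_divide_times abs less_top[symmetric] zero_less_iff_neq_zero)
    finally show "ennreal (l powr q) * emeasure M I
        \<le> emeasure (density M (\<lambda>x. ennreal (\<phi> x powr q))) I"
      using I sets_T assms by (intro density_powr_ge_of_average_ge) auto
  qed (auto intro!: absolutely_continuousI_density)
qed

text \<open>Holds at every point and not just almost everywhere, since each average ignores null
  sets; an empty supremum in \<open>ennreal\<close> is 0 as well.\<close>

lemma maximal_op_eq_0:
  assumes "AE x in M. \<phi> x = 0"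
  shows "maximal_op M T \<phi> x = 0"
proof -
  have "(\<integral>\<^sup>+y\<in>I. ennreal \<bar>\<phi> y\<bar> \<partial>M) = (\<integral>\<^sup>+y. 0 \<partial>M)" for I
    using assms by (intro nn_integral_cong_AE) auto
  then show ?thesis
    by (auto simp: maximal_op_def bot_ennreal intro!: antisym SUP_least)
qed

text \<open>The whole space, of measure 1, is one of the sets in the supremum.\<close>

lemma average_le_maximal_op:
  assumes "prob_space M" "space M \<in> T" "x \<in> space M"
  shows "(\<integral>\<^sup>+y. ennreal \<bar>\<phi> y\<bar> \<partial>M) \<le> maximal_op M T \<phi> x"
proof -
  have "(\<integral>\<^sup>+y\<in>space M. ennreal \<bar>\<phi> y\<bar> \<partial>M) / emeasure M (space M) \<le> maximal_op M T \<phi> x"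
    unfolding maximal_op_def using assms by (intro SUP_upper) auto
  moreover have "(\<integral>\<^sup>+y\<in>space M. ennreal \<bar>\<phi> y\<bar> \<partial>M) = (\<integral>\<^sup>+y. ennreal \<bar>\<phi> y\<bar> \<partial>M)"
    by (intro nn_integral_cong) simp
  ultimately show ?thesis
    using prob_space.emeasure_space_1[OF assms(1)] by (simp add: divide_ennreal_def)
qed

section \<open>The integral inequality\<close>

theorem lemma4p1:
  fixes M :: "'a measure" and T :: "'a set set" and \<phi> :: "'a \<Rightarrow> real"
    and p q f A :: real
  assumes "1 < q" and "q < p"
    and "prob_space M" and "nonatomic M"
    and "is_tree M T"
    and "\<phi> \<in> borel_measurable M" and "\<forall>x\<in>space M. 0 \<le> \<phi> x"
    and "0 \<le> f" and "(\<integral>\<^sup>+x. ennreal (\<phi> x) \<partial>M) = ennreal f"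
    and "0 \<le> A" and "(\<integral>\<^sup>+x. ennreal (\<phi> x powr q) \<partial>M) = ennreal A"
  shows "enn2ereal (\<integral>\<^sup>+x. ennreal_powr (maximal_op M T \<phi> x) p \<partial>M)
    \<le> ereal (f powr p) - ereal (p / (p - q) * f powr (p - q) * A)
      + ereal (p / (p - q)) *
        enn2ereal (\<integral>\<^sup>+x. ennreal_powr (maximal_op M T \<phi> x) (p - q) * ennreal (\<phi> x powr q) \<partial>M)"
proof (cases "f = 0")
  case True
  have "AE x in M. ennreal (\<phi> x) = 0"
    using assms True by (simp add: nn_integral_0_iff_AE)
  with AE_space have 0: "AE x in M. \<phi> x = 0"
    by eventually_elim (use assms in \<open>auto simp: ennreal_eq_0_iff intro: antisym\<close>)
  have "ennreal A = (\<integral>\<^sup>+x. 0 \<partial>M)"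
    unfolding assms(11)[symmetric] using 0 by (intro nn_integral_cong_AE) auto
  then show ?thesis
    using True assms by (simp add: maximal_op_eq_0[OF 0] ennreal_powr_def zero_ennreal.rep_eq)
next
  case False
  with assms have f: "0 < f" by simp
  interpret prob_space M by fact
  note [measurable] = assms(6)
  let ?m = "maximal_op M T \<phi>"
  define N where "N = density M (\<lambda>x. ennreal (\<phi> x powr q))"
  have sets_N[measurable_cong]: "sets N = sets M" and space_N: "space N = space M"
    by (simp_all add: N_def)
  have mass_N: "emeasure N (space M) = ennreal A"
    using assms by (simp add: N_def emeasure_density cong: nn_integral_cong)
  have fin_N: "finite_measure N"
    by (rule finite_measureI) (simp add: space_N mass_N)
  interpret N: finite_measure N by fact
  have m[measurable]: "?m \<in> borel_measurable M"
    using is_tree_sets is_tree_countable assms by (intro borel_measurable_maximal_op) auto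
  have abs: "(\<integral>\<^sup>+x. ennreal \<bar>\<phi> x\<bar> \<partial>M) = ennreal f"
    unfolding assms(9)[symmetric] using assms(7) by (intro nn_integral_cong) simp
  have le: "ennreal f \<le> ?m x" if "x \<in> space M" for x
    using average_le_maximal_op[of M T x \<phi>] that assms abs by (simp add: is_tree_def)
  define E where "E l = {x\<in>space M. ennreal l < ?m x}" for l
  \<comment> \<open>The tail of the layer cake formula for exponent p - q and the measure
    \<open>N\<close>. The integral with exponent p - q equals f^(p-q) A + K, and the one with
    exponent p is at most f^p + p/(p-q) K.\<close>
  define K where "K = (\<integral>\<^sup>+l\<in>{f..}. ennreal ((p - q) * l powr (p - q - 1)) * emeasure N (E l) \<partial>lborel)"
  have [measurable]: "(\<lambda>l. emeasure N (E l)) \<in> borel_measurable lborel"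
    unfolding E_def space_N[symmetric] by measurable
  have "(\<integral>\<^sup>+x. ennreal_powr (?m x) (p - q) * ennreal (\<phi> x powr q) \<partial>M)
      = (\<integral>\<^sup>+x. ennreal_powr (?m x) (p - q) \<partial>N)"
    unfolding N_def ennreal_powr_def by (subst nn_integral_density) (auto simp: mult.commute)
  also have "\<dots> = ennreal (f powr (p - q)) * ennreal A + K"
    using nn_integral_powr_layer_cake[of f "p - q" N ?m] f assms fin_N le
    by (simp add: space_N mass_N K_def E_def cong: measurable_cong_sets)
  finally have J: "(\<integral>\<^sup>+x. ennreal_powr (?m x) (p - q) * ennreal (\<phi> x powr q) \<partial>M)
      = ennreal (f powr (p - q) * A) + K"
    using assms by (simp add: ennreal_mult)
  have "(\<integral>\<^sup>+x. ennreal_powr (?m x) p \<partial>M) = ennreal (f powr p) +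
      (\<integral>\<^sup>+l\<in>{f..}. ennreal (p * l powr (p - 1)) * emeasure M (E l) \<partial>lborel)"
    using nn_integral_powr_layer_cake[of f p M ?m] f assms le m finite_measure_axioms
    by (simp add: emeasure_space_1 E_def)
  also have "(\<integral>\<^sup>+l\<in>{f..}. ennreal (p * l powr (p - 1)) * emeasure M (E l) \<partial>lborel)
      \<le> (\<integral>\<^sup>+l. ennreal (p / (p - q)) *
          (ennreal ((p - q) * l powr (p - q - 1)) * emeasure N (E l) * indicator {f..} l) \<partial>lborel)"
  proof (intro nn_integral_mono)
    fix l :: real
    show "ennreal (p * l powr (p - 1)) * emeasure M (E l) * indicator {f..} l
        \<le> ennreal (p / (p - q)) *
          (ennreal ((p - q) * l powr (p - q - 1)) * emeasure N (E l) * indicator {f..} l)"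
    proof (cases "f \<le> l")
      case True
      \<comment> \<open>Splits off the factor l^q that the weak type bound absorbs; the remaining
        weight is p/(p-q) times the one in \<open>K\<close>.\<close>
      have "l powr (p - 1) = l powr (p - q - 1) * l powr q"
        by (simp flip: powr_add)
      then have "ennreal (p * l powr (p - 1)) * emeasure M (E l)
          = ennreal (p * l powr (p - q - 1)) * (ennreal (l powr q) * emeasure M (E l))"
        using assms by (simp add: ennreal_mult' mult.assoc flip: mult.assoc)
      also have "\<dots> \<le> ennreal (p * l powr (p - q - 1)) * emeasure N (E l)"
        unfolding E_def N_def using assms f True finite_measure_axioms
        by (intro mult_left_mono maximal_op_weak_type) auto
      also have "p * l powr (p - q - 1) = p / (p - q) * ((p - q) * l powr (p - q - 1))"
        using assms by simp
      also have "ennreal \<dots> = ennreal (p / (p - q)) * ennreal ((p - q) * l powr (p - q - 1))"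
        using assms by (intro ennreal_mult) auto
      finally show ?thesis
        using True by (simp add: mult.assoc)
    qed simp
  qed
  also have "\<dots> = ennreal (p / (p - q)) * K"
    unfolding K_def by (rule nn_integral_cmult) measurable
  finally have I: "(\<integral>\<^sup>+x. ennreal_powr (?m x) p \<partial>M) \<le> ennreal (f powr p) + ennreal (p / (p - q)) * K"
    by (simp add: add_left_mono)
  show ?thesis
  \<comment> \<open>The right-hand side contains a subtraction in \<open>ereal\<close>. For finite
    \<open>K\<close> it is a computation with reals; for infinite \<open>K\<close> the right-hand
    side is infinite because p/(p-q) > 0.\<close>
  proof (cases K)
    case (real k)
    then have "(\<integral>\<^sup>+x. ennreal_powr (?m x) p \<partial>M) \<le> ennreal (f powr p + p / (p - q) * k)"
      using I assms by (simp add: ennreal_mult ennreal_plus flip: times_divide_eq_left)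
    then have "enn2ereal (\<integral>\<^sup>+x. ennreal_powr (?m x) p \<partial>M) \<le> ereal (f powr p + p / (p - q) * k)"
      using real assms
      by (simp add: less_eq_ennreal.rep_eq enn2ereal_ennreal del: ennreal_plus)
    \<comment> \<open>The subtracted term cancels the contribution of f^(p-q) A to the integral with
      exponent p - q.\<close>
    also have "f powr p + p / (p - q) * k = f powr p - p / (p - q) * f powr (p - q) * A
        + p / (p - q) * (f powr (p - q) * A + k)"
      by (simp add: algebra_simps)
    finally show ?thesis
      unfolding J using real assms by (simp add: enn2ereal_ennreal flip: ennreal_plus)
  next
    case top
    then show ?thesis
      unfolding J using assms by (simp add: top_ennreal.rep_eq)
  qed
qed

end
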